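(* Let $G$ be a non-cyclic finite group of even order. Then the following are equivalent. (1) There is no element $g\in G$ of odd order such that $\langle g,t\rangle=G$ for every involution $t\in G$. (2) The set of maximal subgroups of $G$ of even order covers $G$.
   Context: A set of subgroups covers $G$ if its union is $G$. An involution is an element of order $2$. *)

theory Defs
  imports "HOL-Algebra.Algebra"
begin

definition involution :: "('a, 'b) monoid_scheme \<Rightarrow> 'a \<Rightarrow> bool" where
  "involution G t \<longleftrightarrow> t \<in> carrier G \<and> group.ord G t = 2"

definition maximal_subgroup :: "'a set \<Rightarrow> ('a, 'b) monoid_scheme \<Rightarrow> bool" where
  "maximal_subgroup M G \<longleftrightarrow>
     subgroup M G \<and> M \<noteq> carrier G \<and>
     (\<forall>H. subgroup H G \<longrightarrow> M \<subseteq> H \<longrightarrow> H = M \<or> H = carrier G)"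

definition covers :: "'a set set \<Rightarrow> ('a, 'b) monoid_scheme \<Rightarrow> bool" where
  "covers \<H> G \<longleftrightarrow> (\<forall>H \<in> \<H>. subgroup H G) \<and> \<Union>\<H> = carrier G"

end

theory Submission
  imports Defs
begin

text \<open>
  An element of odd order fails to generate \<open>G\<close> together with some involution exactly when it lies in
  a maximal subgroup of even order, and an element of even order always lies in one.

  In a finite group every proper subgroup lies in a maximal one, and by Cauchy's theorem for the
  prime 2 a subgroup has even order if and only if it contains an involution. So if \<open>g\<close> and an
  involution \<open>t\<close> do not generate \<open>G\<close>, a maximal subgroup above the subgroup that they generate has
  even order and contains \<open>g\<close>; conversely, a maximal subgroup of even order that contains \<open>g\<close> also
  contains an involution \<open>t\<close>, and \<open>g\<close> and \<open>t\<close> do not generate \<open>G\<close>. An element \<open>x\<close> of even order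
  generates a cyclic subgroup, which is proper because \<open>G\<close> is not cyclic, and a maximal subgroup
  above it has order divisible by the order of \<open>x\<close>.
\<close>

lemma (in group) proper_subgroup_in_maximal_subgroup:
  assumes fin: "finite (carrier G)" and H: "subgroup H G" "H \<noteq> carrier G"
  obtains M where "maximal_subgroup M G" "H \<subseteq> M"
proof -
  let ?S = "{K. subgroup K G \<and> K \<noteq> carrier G}"
  have "?S \<subseteq> Pow (carrier G)"
    using subgroup.subset by blast
  then have "finite ?S"
    using fin by (meson finite_Pow_iff finite_subset)
  then obtain M where M: "M \<in> ?S" "H \<subseteq> M" "\<forall>K\<in>?S. M \<subseteq> K \<longrightarrow> M = K"
    using finite_has_maximal2[of ?S H] H by auto
  then have "maximal_subgroup M G"
    unfolding maximal_subgroup_def by blast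
  with M(2) show thesis using that by blast
qed

lemma (in group) ord_dvd_card_subgroup:
  assumes M: "subgroup M G" and x: "x \<in> M"
  shows "ord x dvd card M"
proof -
  interpret M: group "G\<lparr>carrier := M\<rparr>"
    using M by (rule subgroup_imp_group)
  have "x [^]\<^bsub>G\<lparr>carrier := M\<rparr>\<^esub> card M = \<one>"
    using M.pow_order_eq_1[of x] x by (simp add: order_def)
  then have "x [^] card M = \<one>"
    using nat_pow_consistent by simp
  then show ?thesis
    using pow_eq_id x subgroup.mem_carrier[OF M] by blast
qed

text \<open>
  The converse of the previous lemma for the prime 2: the first Sylow theorem applied to the exponent
  1 yields a subgroup of order 2, and its nontrivial element is an involution.
\<close>

lemma (in group) even_subgroup_contains_involution:
  assumes fin: "finite (carrier G)" and M: "subgroup M G" and ev: "even (card M)"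
  obtains t where "t \<in> M" "involution G t"
proof -
  interpret M: group "G\<lparr>carrier := M\<rparr>"
    using M by (rule subgroup_imp_group)
  have finM: "finite M"
    using fin M subgroup.subset finite_subset by blast
  obtain m where "card M = 2 * m" using ev by blast
  then obtain P where P: "subgroup P (G\<lparr>carrier := M\<rparr>)" "card P = 2"
    using sylow_thm[of 2 "G\<lparr>carrier := M\<rparr>" 1 m] M.group_axioms finM
    by (auto simp: order_def)
  have PG: "subgroup P G" and PM: "P \<subseteq> M"
    using incl_subgroup[OF M P(1)] subgroup.subset[OF P(1)] by auto
  have "P \<noteq> {\<one>}" using P(2) by auto
  then obtain t where t: "t \<in> P" "t \<noteq> \<one>"
    using subgroup.one_closed[OF PG] by blast
  have tG: "t \<in> carrier G" using subgroup.mem_carrier[OF PG t(1)] .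
  have "ord t dvd 2"
    using ord_dvd_card_subgroup[OF PG t(1)] P(2) by simp
  moreover have "ord t \<noteq> 1" using ord_eq_1 tG t(2) by blast
  ultimately have "ord t = 2" by (metis two_is_prime_nat prime_nat_iff)
  then show thesis using that t(1) PM tG unfolding involution_def by blast
qed

theorem proposition5p4:
  fixes G :: "('a, 'b) monoid_scheme"
  assumes "group G"
    and "finite (carrier G)"
    and "even (order G)"
    and "\<not> cyclic_group G"
  shows "\<not> (\<exists>g \<in> carrier G. odd (group.ord G g) \<and>
              (\<forall>t. involution G t \<longrightarrow> generate G {g, t} = carrier G))
         \<longleftrightarrow> covers {M. maximal_subgroup M G \<and> even (card M)} G"
    (is "\<not> ?odd_generator \<longleftrightarrow> covers ?E G")
proof -
  interpret group G by fact
  have sub: "subgroup M G" if "M \<in> ?E" for M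
    using that by (simp add: maximal_subgroup_def)
  show ?thesis
  proof
    assume none: "\<not> ?odd_generator"
    have "\<exists>M\<in>?E. x \<in> M" if x: "x \<in> carrier G" for x
    proof -
      \<comment> \<open>The partner \<open>y\<close> of even order forces even order on any subgroup above \<open>x\<close> and \<open>y\<close>: it is
          \<open>x\<close> itself if \<open>x\<close> has even order, and an involution otherwise.\<close>
      obtain y where y: "y \<in> carrier G" "even (ord y)" "generate G {x, y} \<noteq> carrier G"
      proof (cases "even (ord x)")
        case True
        have "generate G {x} \<noteq> carrier G"
          using \<open>\<not> cyclic_group G\<close> x generate_pow[OF x] unfolding cyclic_group
          by (simp add: full_SetCompr_eq) metis
        then show thesis using that[of x] x True by simp
      next
        case False
        then obtain t where "involution G t" "generate G {x, t} \<noteq> carrier G"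
          using none x by blast
        then show thesis using that[of t] by (simp add: involution_def)
      qed
      have "subgroup (generate G {x, y}) G"
        using generate_is_subgroup x y(1) by simp
      then obtain M where M: "maximal_subgroup M G" "generate G {x, y} \<subseteq> M"
        using proper_subgroup_in_maximal_subgroup assms(2) y(3) by blast
      then have "x \<in> M" "y \<in> M"
        using generate.incl[of _ "{x, y}" G] by auto
      moreover have "ord y dvd card M"
        using ord_dvd_card_subgroup M(1) \<open>y \<in> M\<close> unfolding maximal_subgroup_def by blast
      ultimately show ?thesis using M(1) y(2) dvd_trans by blast
    qed
    then show "covers ?E G"
      unfolding covers_def using sub subgroup.subset by blast
  next
    assume cov: "covers ?E G"
    show "\<not> ?odd_generator"
    proof
      assume ?odd_generator
      then obtain g where g: "g \<in> carrier G"
          "\<And>t. involution G t \<Longrightarrow> generate G {g, t} = carrier G"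
        by blast
      obtain M where M: "M \<in> ?E" "g \<in> M"
        using cov g(1) unfolding covers_def by blast
      obtain t where t: "t \<in> M" "involution G t"
        using even_subgroup_contains_involution assms(2) sub[OF M(1)] M(1) by blast
      have "generate G {g, t} \<subseteq> M"
        using generate_subgroup_incl[of "{g, t}" M] sub[OF M(1)] M(2) t(1) by simp
      then have "carrier G \<subseteq> M" using g(2)[OF t(2)] by simp
      then show False
        using M(1) subgroup.subset[OF sub[OF M(1)]] unfolding maximal_subgroup_def by blast
    qed
  qed
qed

end
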